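(* Let $f:\mathcal{R}\to\Omega$ be SP and let $\omega$ be its associated generalized median voter function on $r_\omega$, with $r_\omega$ satisfying the range conditions. Then the associated family of binary decision functions $\{g_\alpha:\mathcal{R}\to\{\underline{\alpha},\overline{\alpha}\}\}_{\alpha\in r_\omega\cap\Omega^2_C}$ is such that for each $\alpha\in r_\omega\cap\Omega^2_C$, $g_\alpha$ is a voting by collections of left-decisive sets.
   Context: Model. $X\subseteq\mathbb{R}$ is a set of alternatives; $N=\{1,\dots,n\}$ is a finite set of agents partitioned into $A$ (with $|A|=a$, possibly $0$) and $D=N\setminus A$ (possibly empty). A preference $R_i$ is a complete, transitive, antisymmetric binary relation on $X$ with strict part $P_i$. For $i\in A$, $\mathcal{R}_i$ is the set of all single-peaked preferences: those for which there is $\rho(R_i)\in X$ such that for all $x,y\in X$, [$\rho(R_i)\ge x>y$ or $\rho(R_i)\le x<y$] implies $x\,P_i\,y$. For $i\in D$, $\mathcal{R}_i$ is the set of all single-dipped preferences: those for which there is $\delta(R_i)\in X$ such that for all $x,y\in X$, [$\delta(R_i)\ge x>y$ or $\delta(R_i)\le x<y$] implies $y\,P_i\,x$. $\mathcal{R}=\times_{i\in N}\mathcal{R}_i$. A social choice rule is a function $f:\mathcal{R}\to X$; $\Omega$ denotes its range, and writing $f:\mathcal{R}\to\Omega$ means that the range of $f$ is $\Omega$. $f$ is strategy-proof (SP) if there are no $i\in N$, $R\in\mathcal{R}$, $R'_i\in\mathcal{R}_i$ with $f(R'_i,R_{-i})\,P_i\,f(R)$. Standing assumptions: $\mathbb{R}\setminus\Omega$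 is either empty or a union of open sets, and $|\Omega|\ge2$. For $i\in A$, $p(R_i)$ is the best element of $\Omega$ under $R_i$; $p(R)=(p(R_i))_{i\in A}\in\Omega^a$ (for $a=0$, $\Omega^a$ contains only the empty vector). For $\mathbf{p}\in\Omega^a$, $\omega(\mathbf{p})=\Omega(\mathbf{p})=\{x\in\Omega:\exists R\in\mathcal{R},\ p(R)=\mathbf{p},\ f(R)=x\}$, where a singleton is identified with its element and a two-element set $\{x,y\}$, $x<y$, with the ordered pair $(x,y)$ (for SP rules $|\Omega(\mathbf{p})|\le2$). $r_\omega$ is the range of $\omega$. $\Omega^2_C=\{(x,y)\in\Omega\times\Omega: x<y,\ (x,y)\cap\Omega=\emptyset\}$ (in the last condition $(x,y)$ is the open interval). For $\alpha=(x,y)\in\Omega^2_C$ put $\underline{\alpha}=x$, $\overline{\alpha}=y$. The order $\leq^*$ on $\Omega\cup\Omega^2_C$ (strict part $<^*$) is the complete transitive relation that agrees with $\le$ on $\Omega$ and satisfies $x<^*(x,y)<^*y$ for each $(x,y)\in\Omega^2_C$. Range conditions on $r_\omega$: (1) $\Omega\setminus\{\min\Omega,\max\Omega\}\subseteq r_\omega\subseteq\Omega\cup\Omega^2_C$ (removing $\min\Omega,\max\Omega$ when they exist); (2) if $\min\Omega$ exists and there is no $x\in\Omega$ with $(\min\Omega,x)\in r_\omega$, then $\min\Omega\in r_\omega$; (3) if $\max\Omega$ exists and there is no $x\in\Omega$ with $(x,\max\Omega)\in r_\omega$, then $\max\Omega\in r_\omega$. A left coalition system on $r_\omega$ is a map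 $\mathcal{L}$ assigning to each $\alpha\in r_\omega$ a collection $\mathcal{L}(\alpha)\subseteq2^A$ such that: (i) if $C\in\mathcal{L}(\alpha)$ and $C\subset C'\subseteq A$, then $C'\in\mathcal{L}(\alpha)$; (ii) if $\alpha<^*\beta$ and $C\in\mathcal{L}(\alpha)$, then $C\in\mathcal{L}(\beta)$; (iii) if $\max\Omega$ exists and $\max\Omega\notin r_\omega$, then $\emptyset\in\mathcal{L}(\max r_\omega)\setminus\mathcal{L}(\alpha)$ for each $\alpha\in r_\omega\setminus\{\max r_\omega\}$ (max with respect to $\leq^*$); (iv) if $\max\Omega$ does not exist, then $\emptyset\notin\mathcal{L}(\alpha)$ for each $\alpha\in r_\omega$. That $\omega$ is a generalized median voter function on $r_\omega$ means that there is a left coalition system $\mathcal{L}$ on $r_\omega$ (the associated one, fixed in what follows) such that for each $\mathbf{p}\in\Omega^a$ and $\alpha\in r_\omega$: $\omega(\mathbf{p})=\alpha$ if and only if $\{i\in A:\mathbf{p}_i\leq^*\alpha\}\in\mathcal{L}(\alpha)$ and $\{i\in A:\mathbf{p}_i\leq^*\beta\}\notin\mathcal{L}(\beta)$ for each $\beta\in r_\omega$ with $\beta<^*\alpha$. Associated binary decision functions: for $\alpha\in r_\omega\cap\Omega^2_C$, $g_\alpha:\mathcal{R}\to\{\underline{\alpha},\overline{\alpha}\}$ satisfies $g_\alpha(R)=f(R)$ for every $R$ with $\omega(p(R))=\alpha$ (only these profiles matter). A coalition $B$ is minimal in a collection $V$ if $B\in V$ and no proper subset of $B$ is in $V$; $V$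 is minimal if all its members are minimal in $V$. For $\alpha\in r_\omega\cap\Omega^2_C$, let $L_\alpha(R)=\{i\in N:\underline{\alpha}\,P_i\,\overline{\alpha}\}$. The function $g_\alpha$ is a voting by collections of left-decisive sets if there is a minimal collection $W(g_\alpha)\subseteq2^N$ such that for each $R\in\mathcal{R}$ with $\omega(p(R))=\alpha$, $g_\alpha(R)=\underline{\alpha}$ if $C\subseteq L_\alpha(R)$ for some $C\in W(g_\alpha)$ and $g_\alpha(R)=\overline{\alpha}$ otherwise, and moreover: (i) $C\cap D\ne\emptyset$ for each $C\in W(g_\alpha)$; (ii) for each minimal coalition $B$ of $\mathcal{L}(\alpha)\setminus\mathcal{L}(\underline{\alpha})$ there is $C\in W(g_\alpha)$ with $C\cap A=B$ (with the convention $\mathcal{L}(\underline{\alpha})=\emptyset$ if $\underline{\alpha}\notin r_\omega$). *)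

theory Defs
  imports Complex_Main "HOL-Library.FuncSet"
begin

section \<open>Preferences and profiles\<close>

text \<open>A preference over \<open>X\<close> is a relation \<open>r \<subseteq> X \<times> X\<close>; \<open>(x, y) \<in> r\<close> reads
  ``\<open>x\<close> is at least as good as \<open>y\<close>''.  Completeness is meant for all pairs, hence includes
  reflexivity.\<close>

type_synonym pref = "(real \<times> real) set"
type_synonym profile = "nat \<Rightarrow> pref"

definition preferences :: "real set \<Rightarrow> pref set" where
  "preferences X =
    {r. r \<subseteq> X \<times> X \<and> (\<forall>x\<in>X. \<forall>y\<in>X. (x, y) \<in> r \<or> (y, x) \<in> r) \<and> trans r \<and> antisym r}"

definition prefers :: "pref \<Rightarrow> real \<Rightarrow> real \<Rightarrow> bool" where
  "prefers r x y \<longleftrightarrow> (x, y) \<in> r \<and> (y, x) \<notin> r"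

definition single_peaked :: "real set \<Rightarrow> pref set" where
  "single_peaked X =
    {r \<in> preferences X. \<exists>\<rho>\<in>X. \<forall>x\<in>X. \<forall>y\<in>X.
        (\<rho> \<ge> x \<and> x > y) \<or> (\<rho> \<le> x \<and> x < y) \<longrightarrow> prefers r x y}"

definition single_dipped :: "real set \<Rightarrow> pref set" where
  "single_dipped X =
    {r \<in> preferences X. \<exists>\<delta>\<in>X. \<forall>x\<in>X. \<forall>y\<in>X.
        (\<delta> \<ge> x \<and> x > y) \<or> (\<delta> \<le> x \<and> x < y) \<longrightarrow> prefers r y x}"

text \<open>Profiles are extensional functions on the agent set \<open>{1..n}\<close>; \<open>A\<close> is the set of agents with
  single-peaked preferences, and the remaining agents have single-dipped ones.\<close>

definition profiles :: "real set \<Rightarrow> nat \<Rightarrow> nat set \<Rightarrow> profile set" where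
  "profiles X n A =
    (\<Pi>\<^sub>E i\<in>{1..n}. if i \<in> A then single_peaked X else single_dipped X)"

definition strategy_proof ::
    "real set \<Rightarrow> nat \<Rightarrow> nat set \<Rightarrow> (profile \<Rightarrow> real) \<Rightarrow> bool" where
  "strategy_proof X n A f \<longleftrightarrow>
    \<not> (\<exists>i\<in>{1..n}. \<exists>R\<in>profiles X n A.
         \<exists>r\<in>(if i \<in> A then single_peaked X else single_dipped X).
           prefers (R i) (f (R(i := r))) (f R))"

section \<open>Tops and the associated map \<open>\<omega>\<close>\<close>

definition best :: "real set \<Rightarrow> pref \<Rightarrow> real" where
  "best \<Omega> r = (THE x. x \<in> \<Omega> \<and> (\<forall>y\<in>\<Omega>. (x, y) \<in> r))"

definition tops :: "real set \<Rightarrow> nat set \<Rightarrow> profile \<Rightarrow> nat \<Rightarrow> real" where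
  "tops \<Omega> A R = (\<lambda>i\<in>A. best \<Omega> (R i))"

text \<open>A vector of tops is an element of \<open>A \<rightarrow>\<^sub>E \<Omega>\<close>, which for \<open>A = {}\<close> has exactly one element.

  An element \<open>x\<close> of \<open>\<Omega>\<close> is identified with the singleton \<open>{x}\<close>, and a pair \<open>(x, y)\<close> with \<open>x < y\<close>
  is identified with \<open>{x, y}\<close>.  Thus the values of \<open>\<omega>\<close>, the elements of \<open>\<Omega> \<union> \<Omega>\<^sup>2\<^sub>C\<close>, and the
  arguments of a left coalition system are sets of reals, and \<open>\<omega>(p)\<close> is literally \<open>\<Omega>(p)\<close>.\<close>

definition omega ::
    "real set \<Rightarrow> nat \<Rightarrow> nat set \<Rightarrow> (profile \<Rightarrow> real) \<Rightarrow> (nat \<Rightarrow> real) \<Rightarrow> real set" where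
  "omega X n A f p =
    (let \<Omega> = f ` profiles X n A in {x \<in> \<Omega>. \<exists>R\<in>profiles X n A. tops \<Omega> A R = p \<and> f R = x})"

definition r_omega :: "real set \<Rightarrow> nat \<Rightarrow> nat set \<Rightarrow> (profile \<Rightarrow> real) \<Rightarrow> real set set" where
  "r_omega X n A f = omega X n A f ` (A \<rightarrow>\<^sub>E f ` profiles X n A)"

definition points :: "real set \<Rightarrow> real set set" where
  "points \<Omega> = {{x} | x. x \<in> \<Omega>}"

definition gaps :: "real set \<Rightarrow> real set set" where
  "gaps \<Omega> = {{x, y} | x y. x \<in> \<Omega> \<and> y \<in> \<Omega> \<and> x < y \<and> {x<..<y} \<inter> \<Omega> = {}}"

definition lower :: "real set \<Rightarrow> real" where
  "lower \<alpha> = Min \<alpha>"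

definition upper :: "real set \<Rightarrow> real" where
  "upper \<alpha> = Max \<alpha>"

definition star_le :: "real set \<Rightarrow> real set \<Rightarrow> bool" (infix "\<le>\<^sup>*" 50) where
  "\<alpha> \<le>\<^sup>* \<beta> \<longleftrightarrow> lower \<alpha> \<le> lower \<beta> \<and> upper \<alpha> \<le> upper \<beta>"

definition star_less :: "real set \<Rightarrow> real set \<Rightarrow> bool" (infix "<\<^sup>*" 50) where
  "\<alpha> <\<^sup>* \<beta> \<longleftrightarrow> \<alpha> \<le>\<^sup>* \<beta> \<and> \<not> \<beta> \<le>\<^sup>* \<alpha>"

text \<open>The following lemmas show that \<open>\<le>\<^sup>*\<close> is the complete transitive relation on \<open>\<Omega> \<union> \<Omega>\<^sup>2\<^sub>C\<close> that
  agrees with \<open>\<le>\<close> on \<open>\<Omega>\<close> and puts the pair \<open>(x, y)\<close> strictly between \<open>x\<close> and \<open>y\<close>.\<close>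

lemma star_le_point [simp]: "{x} \<le>\<^sup>* {y} \<longleftrightarrow> x \<le> y"
  by (simp add: star_le_def lower_def upper_def)

lemma star_less_gap:
  assumes "x < y"
  shows "{x} <\<^sup>* {x, y}" "{x, y} <\<^sup>* {y}"
  using assms by (simp_all add: star_less_def star_le_def lower_def upper_def)

lemma star_le_trans: "\<alpha> \<le>\<^sup>* \<beta> \<Longrightarrow> \<beta> \<le>\<^sup>* \<gamma> \<Longrightarrow> \<alpha> \<le>\<^sup>* \<gamma>"
  by (auto simp: star_le_def)

lemma star_le_total:
  assumes "\<alpha> \<in> points \<Omega> \<union> gaps \<Omega>" "\<beta> \<in> points \<Omega> \<union> gaps \<Omega>"
  shows "\<alpha> \<le>\<^sup>* \<beta> \<or> \<beta> \<le>\<^sup>* \<alpha>"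
proof -
  have bounds: "lower \<gamma> \<in> \<Omega> \<and> upper \<gamma> \<in> \<Omega> \<and> lower \<gamma> \<le> upper \<gamma> \<and> {lower \<gamma><..<upper \<gamma>} \<inter> \<Omega> = {}"
    if "\<gamma> \<in> points \<Omega> \<union> gaps \<Omega>" for \<gamma>
    using that by (auto simp: points_def gaps_def lower_def upper_def)
  show ?thesis
    using bounds[OF assms(1)] bounds[OF assms(2)]
    by (fastforce simp: star_le_def disjoint_iff)
qed

section \<open>Range conditions\<close>

definition is_min :: "real set \<Rightarrow> real \<Rightarrow> bool" where
  "is_min \<Omega> m \<longleftrightarrow> m \<in> \<Omega> \<and> (\<forall>x\<in>\<Omega>. m \<le> x)"

definition is_max :: "real set \<Rightarrow> real \<Rightarrow> bool" where
  "is_max \<Omega> m \<longleftrightarrow> m \<in> \<Omega> \<and> (\<forall>x\<in>\<Omega>. x \<le> m)"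

definition range_conditions :: "real set \<Rightarrow> real set set \<Rightarrow> bool" where
  "range_conditions \<Omega> r \<longleftrightarrow>
    points {x \<in> \<Omega>. \<not> is_min \<Omega> x \<and> \<not> is_max \<Omega> x} \<subseteq> r \<and> r \<subseteq> points \<Omega> \<union> gaps \<Omega> \<and>
    (\<forall>m. is_min \<Omega> m \<and> \<not> (\<exists>x\<in>\<Omega>. m < x \<and> {m, x} \<in> r) \<longrightarrow> {m} \<in> r) \<and>
    (\<forall>m. is_max \<Omega> m \<and> \<not> (\<exists>x\<in>\<Omega>. x < m \<and> {x, m} \<in> r) \<longrightarrow> {m} \<in> r)"

section \<open>Generalized median voter functions\<close>

definition left_coalition_system ::
    "real set \<Rightarrow> nat set \<Rightarrow> real set set \<Rightarrow> (real set \<Rightarrow> nat set set) \<Rightarrow> bool" where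
  "left_coalition_system \<Omega> A r L \<longleftrightarrow>
    (\<forall>\<alpha>\<in>r. L \<alpha> \<subseteq> Pow A) \<and>
    (\<forall>\<alpha>\<in>r. \<forall>C C'. C \<in> L \<alpha> \<and> C \<subset> C' \<and> C' \<subseteq> A \<longrightarrow> C' \<in> L \<alpha>) \<and>
    (\<forall>\<alpha>\<in>r. \<forall>\<beta>\<in>r. \<forall>C. \<alpha> <\<^sup>* \<beta> \<and> C \<in> L \<alpha> \<longrightarrow> C \<in> L \<beta>) \<and>
    (\<forall>m. is_max \<Omega> m \<and> {m} \<notin> r \<longrightarrow>
      (\<exists>\<mu>\<in>r. (\<forall>\<beta>\<in>r. \<beta> \<le>\<^sup>* \<mu>) \<and> (\<forall>\<alpha>\<in>r - {\<mu>}. {} \<in> L \<mu> - L \<alpha>))) \<and>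
    ((\<nexists>m. is_max \<Omega> m) \<longrightarrow> (\<forall>\<alpha>\<in>r. {} \<notin> L \<alpha>))"

definition generalized_median_with ::
    "real set \<Rightarrow> nat set \<Rightarrow> ((nat \<Rightarrow> real) \<Rightarrow> real set) \<Rightarrow> real set set
      \<Rightarrow> (real set \<Rightarrow> nat set set) \<Rightarrow> bool" where
  "generalized_median_with \<Omega> A w r L \<longleftrightarrow>
    left_coalition_system \<Omega> A r L \<and>
    (\<forall>p\<in>A \<rightarrow>\<^sub>E \<Omega>. \<forall>\<alpha>\<in>r. w p = \<alpha> \<longleftrightarrow>
      {i \<in> A. {p i} \<le>\<^sup>* \<alpha>} \<in> L \<alpha> \<and>
      (\<forall>\<beta>\<in>r. \<beta> <\<^sup>* \<alpha> \<longrightarrow> {i \<in> A. {p i} \<le>\<^sup>* \<beta>} \<notin> L \<beta>))"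

section \<open>Binary decision functions and left-decisive sets\<close>

definition binary_decision_functions ::
    "real set \<Rightarrow> nat \<Rightarrow> nat set \<Rightarrow> (profile \<Rightarrow> real) \<Rightarrow> (real set \<Rightarrow> profile \<Rightarrow> real) \<Rightarrow> bool" where
  "binary_decision_functions X n A f g \<longleftrightarrow>
    (let \<Omega> = f ` profiles X n A in
      \<forall>\<alpha>\<in>r_omega X n A f \<inter> gaps \<Omega>.
        g \<alpha> \<in> profiles X n A \<rightarrow> {lower \<alpha>, upper \<alpha>} \<and>
        (\<forall>R\<in>profiles X n A. omega X n A f (tops \<Omega> A R) = \<alpha> \<longrightarrow> g \<alpha> R = f R))"

definition minimal_in :: "nat set set \<Rightarrow> nat set \<Rightarrow> bool" where
  "minimal_in V B \<longleftrightarrow> B \<in> V \<and> \<not> (\<exists>C\<in>V. C \<subset> B)"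

definition minimal_collection :: "nat set set \<Rightarrow> bool" where
  "minimal_collection V \<longleftrightarrow> (\<forall>B\<in>V. minimal_in V B)"

definition left_supporters :: "nat \<Rightarrow> real set \<Rightarrow> profile \<Rightarrow> nat set" where
  "left_supporters n \<alpha> R = {i \<in> {1..n}. prefers (R i) (lower \<alpha>) (upper \<alpha>)}"

definition voting_by_left_decisive_sets ::
    "real set \<Rightarrow> nat \<Rightarrow> nat set \<Rightarrow> (profile \<Rightarrow> real) \<Rightarrow> (real set \<Rightarrow> nat set set)
      \<Rightarrow> real set \<Rightarrow> (profile \<Rightarrow> real) \<Rightarrow> bool" where
  "voting_by_left_decisive_sets X n A f L \<alpha> h \<longleftrightarrow>
    (\<exists>W \<subseteq> Pow {1..n}. minimal_collection W \<and>
      (\<forall>R\<in>profiles X n A. omega X n A f (tops (f ` profiles X n A) A R) = \<alpha> \<longrightarrow>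
        h R = (if \<exists>C\<in>W. C \<subseteq> left_supporters n \<alpha> R then lower \<alpha> else upper \<alpha>)) \<and>
      (\<forall>C\<in>W. C \<inter> ({1..n} - A) \<noteq> {}) \<and>
      (\<forall>B. minimal_in (L \<alpha> - (if {lower \<alpha>} \<in> r_omega X n A f then L {lower \<alpha>} else {})) B \<longrightarrow>
        (\<exists>C\<in>W. C \<inter> A = B)))"

end

(* Let \<alpha> = {x, y} be a gap in the range of \<omega>.  A single-peaked agent prefers x to y iff its top is
   at most x, and \<omega>(p) = \<alpha> iff {i. p i \<le> x} belongs to L(\<alpha>) but not to L({x}).  Since the latter
   collection is order-convex, one can pass between two profiles with \<omega> = \<alpha> and nested sets of
   supporters of x by switching the agents one at a time without leaving \<omega> = \<alpha>; strategy-proofness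
   then shows that the choice of x is monotone in the set of supporters.  The minimal supporting
   sets form the left-decisive collection. *)
theory Submission
  imports Defs "HOL-Analysis.Elementary_Metric_Spaces"
begin

section \<open>Single-peaked preferences: tops on a closed range and comparisons across a
  gap\<close>

lemma gapsE:
  assumes "\<alpha> \<in> gaps \<Omega>"
  obtains x y where "\<alpha> = {x, y}" "x \<in> \<Omega>" "y \<in> \<Omega>" "x < y" "{x<..<y} \<inter> \<Omega> = {}"
    "lower \<alpha> = x" "upper \<alpha> = y"
  using assms unfolding gaps_def lower_def upper_def by force

lemma single_peakedE:
  assumes "r \<in> single_peaked X"
  obtains \<rho> where "\<rho> \<in> X"
    "\<And>x y. x \<in> X \<Longrightarrow> y \<in> X \<Longrightarrow> \<rho> \<ge> x \<Longrightarrow> x > y \<Longrightarrow> prefers r x y"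
    "\<And>x y. x \<in> X \<Longrightarrow> y \<in> X \<Longrightarrow> \<rho> \<le> x \<Longrightarrow> x < y \<Longrightarrow> prefers r x y"
  using assms unfolding single_peaked_def by blast

text \<open>\<open>best\<close> is a definite description, so existence and uniqueness are both at
  stake. The peak \<open>\<rho>\<close> may lie outside \<open>\<Omega>\<close>. Closedness makes
  the nearest elements of \<open>\<Omega>\<close> on either side of \<open>\<rho>\<close> attained;
  each is the best on its side, and the better of the two is the best overall. Antisymmetry gives
  uniqueness.\<close>

lemma best_single_peaked:
  assumes r: "r \<in> single_peaked X" and "\<Omega> \<subseteq> X" "closed \<Omega>" "\<Omega> \<noteq> {}"
  shows "best \<Omega> r \<in> \<Omega> \<and> (\<forall>y\<in>\<Omega>. (best \<Omega> r, y) \<in> r)"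
proof -
  obtain \<rho> where
    down: "\<And>x y. x \<in> X \<Longrightarrow> y \<in> X \<Longrightarrow> \<rho> \<ge> x \<Longrightarrow> x > y \<Longrightarrow> prefers r x y" and
    up: "\<And>x y. x \<in> X \<Longrightarrow> y \<in> X \<Longrightarrow> \<rho> \<le> x \<Longrightarrow> x < y \<Longrightarrow> prefers r x y"
    using r by (rule single_peakedE) blast
  have pref: "r \<in> preferences X" using r by (simp add: single_peaked_def)
  then have total: "\<And>x y. x \<in> X \<Longrightarrow> y \<in> X \<Longrightarrow> (x, y) \<in> r \<or> (y, x) \<in> r"
    and "trans r" "antisym r"
    by (auto simp: preferences_def)
  have left: "\<exists>l\<in>\<Omega>. \<forall>y\<in>\<Omega>. y \<le> \<rho> \<longrightarrow> (l, y) \<in> r" if "\<Omega> \<inter> {..\<rho>} \<noteq> {}"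
  proof
    let ?l = "Sup (\<Omega> \<inter> {..\<rho>})"
    have bdd: "bdd_above (\<Omega> \<inter> {..\<rho>})" by auto
    then have "?l \<in> \<Omega> \<inter> {..\<rho>}"
      using that \<open>closed \<Omega>\<close> by (intro closed_contains_Sup) auto
    then show "?l \<in> \<Omega>" by blast
    show "\<forall>y\<in>\<Omega>. y \<le> \<rho> \<longrightarrow> (?l, y) \<in> r"
    proof (intro ballI impI)
      fix y assume y: "y \<in> \<Omega>" "y \<le> \<rho>"
      then have "y \<le> ?l" using bdd by (intro cSup_upper) auto
      then show "(?l, y) \<in> r"
        using down[of ?l y] total[of y y] y \<open>?l \<in> \<Omega> \<inter> {..\<rho>}\<close> \<open>\<Omega> \<subseteq> X\<close>
        by (cases "y = ?l") (auto simp: prefers_def)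
    qed
  qed
  have right: "\<exists>u\<in>\<Omega>. \<forall>y\<in>\<Omega>. \<rho> \<le> y \<longrightarrow> (u, y) \<in> r" if "\<Omega> \<inter> {\<rho>..} \<noteq> {}"
  proof
    let ?u = "Inf (\<Omega> \<inter> {\<rho>..})"
    have bdd: "bdd_below (\<Omega> \<inter> {\<rho>..})" by auto
    then have "?u \<in> \<Omega> \<inter> {\<rho>..}"
      using that \<open>closed \<Omega>\<close> by (intro closed_contains_Inf) auto
    then show "?u \<in> \<Omega>" by blast
    show "\<forall>y\<in>\<Omega>. \<rho> \<le> y \<longrightarrow> (?u, y) \<in> r"
    proof (intro ballI impI)
      fix y assume y: "y \<in> \<Omega>" "\<rho> \<le> y"
      then have "?u \<le> y" using bdd by (intro cInf_lower) auto
      then show "(?u, y) \<in> r"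
        using up[of ?u y] total[of y y] y \<open>?u \<in> \<Omega> \<inter> {\<rho>..}\<close> \<open>\<Omega> \<subseteq> X\<close>
        by (cases "y = ?u") (auto simp: prefers_def)
    qed
  qed
  have "\<exists>x\<in>\<Omega>. \<forall>y\<in>\<Omega>. (x, y) \<in> r"
  proof (cases "\<Omega> \<inter> {..\<rho>} = {} \<or> \<Omega> \<inter> {\<rho>..} = {}")
    case True
    then consider "\<Omega> \<inter> {..\<rho>} = {}" "\<forall>y\<in>\<Omega>. \<rho> \<le> y" | "\<Omega> \<inter> {\<rho>..} = {}" "\<forall>y\<in>\<Omega>. y \<le> \<rho>"
      by (force simp: disjoint_iff)
    then show ?thesis
    proof cases
      case 1
      then have "\<Omega> \<inter> {\<rho>..} \<noteq> {}" using \<open>\<Omega> \<noteq> {}\<close> by blast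
      then show ?thesis using right 1(2) by blast
    next
      case 2
      then have "\<Omega> \<inter> {..\<rho>} \<noteq> {}" using \<open>\<Omega> \<noteq> {}\<close> by blast
      then show ?thesis using left 2(2) by blast
    qed
  next
    case False
    then obtain l u where "l \<in> \<Omega>" "u \<in> \<Omega>"
      and lu: "\<forall>y\<in>\<Omega>. y \<le> \<rho> \<longrightarrow> (l, y) \<in> r" "\<forall>y\<in>\<Omega>. \<rho> \<le> y \<longrightarrow> (u, y) \<in> r"
      using left right by blast
    then show ?thesis
      using total[of l u] \<open>\<Omega> \<subseteq> X\<close> \<open>trans r\<close> by (meson linear subsetD transD)
  qed
  then have "\<exists>!x. x \<in> \<Omega> \<and> (\<forall>y\<in>\<Omega>. (x, y) \<in> r)"
    using \<open>antisym r\<close> by (blast dest: antisymD)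
  then show ?thesis unfolding best_def by (rule theI')
qed

text \<open>The top cannot lie inside the gap. If it lies below \<open>x\<close>, then so does the
  peak, since otherwise \<open>x\<close> would beat the top; hence \<open>x\<close> and
  \<open>y\<close> are both to the right of the peak and the nearer one wins. The case above
  \<open>y\<close> is symmetric, and a top at \<open>x\<close> or \<open>y\<close> decides the pair
  directly.\<close>

lemma prefers_gap_iff_best_le:
  assumes r: "r \<in> single_peaked X" and "\<Omega> \<subseteq> X" "closed \<Omega>"
    and "x \<in> \<Omega>" "y \<in> \<Omega>" "x < y" "{x<..<y} \<inter> \<Omega> = {}"
  shows "prefers r x y \<longleftrightarrow> best \<Omega> r \<le> x"
proof -
  let ?b = "best \<Omega> r"
  obtain \<rho> where
    down: "\<And>x y. x \<in> X \<Longrightarrow> y \<in> X \<Longrightarrow> \<rho> \<ge> x \<Longrightarrow> x > y \<Longrightarrow> prefers r x y" and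
    up: "\<And>x y. x \<in> X \<Longrightarrow> y \<in> X \<Longrightarrow> \<rho> \<le> x \<Longrightarrow> x < y \<Longrightarrow> prefers r x y"
    using r by (rule single_peakedE) blast
  have b: "?b \<in> \<Omega>" "\<And>z. z \<in> \<Omega> \<Longrightarrow> \<not> prefers r z ?b"
    using best_single_peaked[OF r \<open>\<Omega> \<subseteq> X\<close> \<open>closed \<Omega>\<close>] \<open>x \<in> \<Omega>\<close> by (auto simp: prefers_def)
  have "antisym r" using r by (simp add: single_peaked_def preferences_def)
  have best: "prefers r ?b z" if "z \<in> \<Omega>" "z \<noteq> ?b" for z
    using best_single_peaked[OF r \<open>\<Omega> \<subseteq> X\<close> \<open>closed \<Omega>\<close>] \<open>antisym r\<close> that
    unfolding prefers_def by (metis antisymD empty_iff)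
  have X: "x \<in> X" "y \<in> X" "?b \<in> X" using assms b by auto
  consider "?b < x" | "?b = x" | "?b = y" | "?b > y"
    using assms(7) b(1) unfolding disjoint_iff greaterThanLessThan_iff by (metis linorder_neqE)
  then show ?thesis
  proof cases
    case 1
    then have "\<rho> < x" using down[of x ?b] X b(2) \<open>x \<in> \<Omega>\<close> by force
    then show ?thesis using up[of x y] X 1 \<open>x < y\<close> by simp
  next
    case 2
    then show ?thesis using best[of y] \<open>y \<in> \<Omega>\<close> \<open>x < y\<close> by simp
  next
    case 3
    then show ?thesis using best[of x] \<open>x \<in> \<Omega>\<close> \<open>x < y\<close> by (simp add: prefers_def)
  next
    case 4
    then have "\<rho> > y" using up[of y ?b] X b(2) \<open>y \<in> \<Omega>\<close> by force
    then show ?thesis using down[of y x] X 4 \<open>x < y\<close> by (simp add: prefers_def)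
  qed
qed

section \<open>The order on points and gaps, and when a generalized median equals a gap\<close>

lemma star_less_gap_imp_le_lower:
  assumes "\<alpha> \<in> gaps \<Omega>" "\<beta> \<in> points \<Omega> \<union> gaps \<Omega>" "\<beta> <\<^sup>* \<alpha>"
  shows "\<beta> \<le>\<^sup>* {lower \<alpha>}"
proof -
  have "lower \<beta> \<in> \<Omega> \<and> upper \<beta> \<in> \<Omega> \<and> lower \<beta> \<le> upper \<beta> \<and> {lower \<beta><..<upper \<beta>} \<inter> \<Omega> = {}"
    using assms(2) by (auto simp: points_def gaps_def lower_def upper_def)
  moreover obtain x y where "x \<in> \<Omega>" "y \<in> \<Omega>" "x < y" "{x<..<y} \<inter> \<Omega> = {}"
    "lower \<alpha> = x" "upper \<alpha> = y"
    using assms(1) by (rule gapsE)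
  moreover have "lower {x} = x" "upper {x} = x" by (simp_all add: lower_def upper_def)
  ultimately show ?thesis
    using assms(3) unfolding star_less_def star_le_def disjoint_iff greaterThanLessThan_iff
    by (metis less_eq_real_def not_le)
qed

lemma star_le_point_cases:
  assumes "\<beta> \<in> points \<Omega> \<union> gaps \<Omega>" "\<beta> \<le>\<^sup>* {x}"
  shows "\<beta> = {x} \<or> \<beta> <\<^sup>* {x}"
  using assms by (auto simp: points_def gaps_def star_less_def star_le_def lower_def upper_def)

lemma left_coalition_system_upward:
  assumes "left_coalition_system \<Omega> A r L" "\<alpha> \<in> r" "C \<in> L \<alpha>" "C \<subseteq> C'" "C' \<subseteq> A"
  shows "C' \<in> L \<alpha>"
proof (cases "C = C'")
  case False
  then have "C \<subset> C'" using assms(4) by blast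
  moreover have "\<forall>\<alpha>\<in>r. \<forall>C C'. C \<in> L \<alpha> \<and> C \<subset> C' \<and> C' \<subseteq> A \<longrightarrow> C' \<in> L \<alpha>"
    using assms(1) unfolding left_coalition_system_def by (elim conjE)
  ultimately show ?thesis using assms(2,3,5) by blast
qed (use assms in simp)

text \<open>The median condition tests every element of \<open>r\<close> below
  \<open>\<alpha>\<close>. All of them are at most \<open>{lower \<alpha>}\<close>, and coalitions
  in \<open>L\<close> persist both upwards along the order and under enlargement, so the single test
  at \<open>{lower \<alpha>}\<close> subsumes the others.\<close>

lemma omega_eq_gap_iff:
  assumes gm: "generalized_median_with \<Omega> A w r L" and rc: "range_conditions \<Omega> r"
    and \<alpha>: "\<alpha> \<in> r" "\<alpha> \<in> gaps \<Omega>" and p: "p \<in> A \<rightarrow>\<^sub>E \<Omega>"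
  shows "w p = \<alpha> \<longleftrightarrow>
    {i \<in> A. p i \<le> lower \<alpha>} \<in> L \<alpha> - (if {lower \<alpha>} \<in> r then L {lower \<alpha>} else {})"
proof -
  obtain x y where xy: "\<alpha> = {x, y}" "x \<in> \<Omega>" "y \<in> \<Omega>" "x < y" "lower \<alpha> = x" "upper \<alpha> = y"
    using \<alpha>(2) by (rule gapsE)
  let ?S = "{i \<in> A. p i \<le> x}"
  have lcs: "left_coalition_system \<Omega> A r L"
    and w: "w p = \<alpha> \<longleftrightarrow> {i \<in> A. {p i} \<le>\<^sup>* \<alpha>} \<in> L \<alpha> \<and>
      (\<forall>\<beta>\<in>r. \<beta> <\<^sup>* \<alpha> \<longrightarrow> {i \<in> A. {p i} \<le>\<^sup>* \<beta>} \<notin> L \<beta>)"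
    using gm p \<alpha>(1) by (auto simp: generalized_median_with_def)
  note upward = left_coalition_system_upward[OF lcs]
  have monotone: "C \<in> L \<gamma>" if "\<beta> \<in> r" "\<gamma> \<in> r" "\<beta> <\<^sup>* \<gamma>" "C \<in> L \<beta>" for \<beta> \<gamma> C
  proof -
    have "\<forall>\<alpha>\<in>r. \<forall>\<beta>\<in>r. \<forall>C. \<alpha> <\<^sup>* \<beta> \<and> C \<in> L \<alpha> \<longrightarrow> C \<in> L \<beta>"
      using lcs unfolding left_coalition_system_def by (elim conjE)
    then show ?thesis using that by blast
  qed
  have S\<alpha>: "{i \<in> A. {p i} \<le>\<^sup>* \<alpha>} = ?S"
    using xy by (auto simp: star_le_def lower_def upper_def)
  have "(\<forall>\<beta>\<in>r. \<beta> <\<^sup>* \<alpha> \<longrightarrow> {i \<in> A. {p i} \<le>\<^sup>* \<beta>} \<notin> L \<beta>) \<longleftrightarrow> ({x} \<in> r \<longrightarrow> ?S \<notin> L {x})"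
  proof
    assume "\<forall>\<beta>\<in>r. \<beta> <\<^sup>* \<alpha> \<longrightarrow> {i \<in> A. {p i} \<le>\<^sup>* \<beta>} \<notin> L \<beta>"
    then show "{x} \<in> r \<longrightarrow> ?S \<notin> L {x}"
      using star_less_gap(1)[OF \<open>x < y\<close>] xy(1) by fastforce
  next
    assume S: "{x} \<in> r \<longrightarrow> ?S \<notin> L {x}"
    show "\<forall>\<beta>\<in>r. \<beta> <\<^sup>* \<alpha> \<longrightarrow> {i \<in> A. {p i} \<le>\<^sup>* \<beta>} \<notin> L \<beta>"
    proof (intro ballI impI notI)
      fix \<beta> assume \<beta>: "\<beta> \<in> r" "\<beta> <\<^sup>* \<alpha>" and C: "{i \<in> A. {p i} \<le>\<^sup>* \<beta>} \<in> L \<beta>"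
      have \<beta>\<Omega>: "\<beta> \<in> points \<Omega> \<union> gaps \<Omega>" using rc \<beta>(1) by (auto simp: range_conditions_def)
      have le: "\<beta> \<le>\<^sup>* {x}" using star_less_gap_imp_le_lower[OF \<alpha>(2) \<beta>\<Omega> \<beta>(2)] xy(5) by simp
      \<comment> \<open>Since \<open>y\<close> lies above \<open>x\<close>, the range conditions
        allow \<open>{x}\<close> to be missing from \<open>r\<close> only when \<open>x\<close> is
        the minimum of \<open>\<Omega>\<close>. Then \<open>\<beta>\<close>, being at most
        \<open>{x}\<close>, would be \<open>{x}\<close> itself, although \<open>\<beta>\<close> is
        in \<open>r\<close>.\<close>
      have "{x} \<in> r"
      proof (rule ccontr)
        assume "{x} \<notin> r"
        moreover have "\<not> is_max \<Omega> x" using xy(3,4) by (force simp: is_max_def)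
        moreover have "points {x \<in> \<Omega>. \<not> is_min \<Omega> x \<and> \<not> is_max \<Omega> x} \<subseteq> r"
          using rc by (simp add: range_conditions_def)
        ultimately have "is_min \<Omega> x" using xy(2) unfolding points_def by blast
        then have "\<beta> = {x}"
          using le \<beta>\<Omega>
          by (fastforce simp: is_min_def points_def gaps_def star_le_def lower_def upper_def)
        then show False using \<beta>(1) \<open>{x} \<notin> r\<close> by simp
      qed
      have "{i \<in> A. {p i} \<le>\<^sup>* \<beta>} \<in> L {x}"
        using star_le_point_cases[OF \<beta>\<Omega> le] C monotone \<beta>(1) \<open>{x} \<in> r\<close> by blast
      moreover have "{i \<in> A. {p i} \<le>\<^sup>* \<beta>} \<subseteq> ?S"
        using star_le_trans[OF _ le] by (metis (no_types, lifting) Collect_mono star_le_point)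
      ultimately have "?S \<in> L {x}"
        using upward[OF \<open>{x} \<in> r\<close>] by blast
      then show False using S \<open>{x} \<in> r\<close> by simp
    qed
  qed
  then show ?thesis using w S\<alpha> xy(5) by simp
qed

section \<open>Left-decisive collections from strategy-proofness\<close>

lemma prefers_cases:
  assumes "r \<in> preferences X" "x \<in> X" "y \<in> X" "x \<noteq> y"
  shows "prefers r x y \<or> prefers r y x"
proof -
  have "antisym r" "(x, y) \<in> r \<or> (y, x) \<in> r"
    using assms by (auto simp: preferences_def)
  then show ?thesis
    using antisymD[of r x y] \<open>x \<noteq> y\<close> unfolding prefers_def by blast
qed

lemma finite_contains_minimal_in:
  assumes "finite S" "S \<in> V"
  shows "\<exists>C. minimal_in V C \<and> C \<subseteq> S"
  using assms
proof (induction S rule: finite_psubset_induct)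
  case (psubset S)
  show ?case
  proof (cases "minimal_in V S")
    case False
    then obtain T where "T \<in> V" "T \<subset> S"
      using psubset.prems by (auto simp: minimal_in_def)
    then show ?thesis using psubset.IH[of T] by blast
  qed blast
qed

theorem proposition4:
  fixes X \<Omega> :: "real set" and n :: nat and A :: "nat set"
    and f :: "profile \<Rightarrow> real"
    and L :: "real set \<Rightarrow> nat set set"
    and g :: "real set \<Rightarrow> profile \<Rightarrow> real"
  assumes "A \<subseteq> {1..n}"
    and "f ` profiles X n A = \<Omega>" and "\<Omega> \<subseteq> X"
    and "open (UNIV - \<Omega>)"
    and "\<exists>x\<in>\<Omega>. \<exists>y\<in>\<Omega>. x \<noteq> y"
    and "strategy_proof X n A f"
    and "range_conditions \<Omega> (r_omega X n A f)"
    and "generalized_median_with \<Omega> A (omega X n A f) (r_omega X n A f) L"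
    and "binary_decision_functions X n A f g"
  shows "\<forall>\<alpha>\<in>r_omega X n A f \<inter> gaps \<Omega>. voting_by_left_decisive_sets X n A f L \<alpha> (g \<alpha>)"
proof
  fix \<alpha> assume "\<alpha> \<in> r_omega X n A f \<inter> gaps \<Omega>"
  then have \<alpha>: "\<alpha> \<in> r_omega X n A f" "\<alpha> \<in> gaps \<Omega>" by auto
  obtain x y where xy: "\<alpha> = {x, y}" "x \<in> \<Omega>" "y \<in> \<Omega>" "x < y" "{x<..<y} \<inter> \<Omega> = {}"
    "lower \<alpha> = x" "upper \<alpha> = y"
    using \<alpha>(2) by (rule gapsE)
  have "closed \<Omega>" using assms(4) by (simp add: closed_def Compl_eq_Diff_UNIV)
  define P where "P = profiles X n A"
  define V where "V = L \<alpha> - (if {x} \<in> r_omega X n A f then L {x} else {})"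
  define Q where "Q = {R \<in> P. omega X n A f (tops \<Omega> A R) = \<alpha>}"
  define S where "S = left_supporters n \<alpha>"
  have lcs: "left_coalition_system \<Omega> A (r_omega X n A f) L"
    using assms(8) by (simp add: generalized_median_with_def)
  have S_iff: "i \<in> S R \<longleftrightarrow> i \<in> {1..n} \<and> prefers (R i) x y" for i R
    using xy by (simp add: S_def left_supporters_def)
  have omega_iff: "omega X n A f p = \<alpha> \<longleftrightarrow> {i \<in> A. p i \<le> x} \<in> V" if "p \<in> A \<rightarrow>\<^sub>E \<Omega>" for p
    using omega_eq_gap_iff[OF assms(8,7) \<alpha> that] unfolding V_def xy(6) .
  have dom: "R i \<in> (if i \<in> A then single_peaked X else single_dipped X)"
    if "R \<in> P" "i \<in> {1..n}" for R i
    using that PiE_mem unfolding P_def profiles_def by fast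
  have agent_pref: "R i \<in> preferences X" if "R \<in> P" "i \<in> {1..n}" for R i
    using dom[OF that] by (auto simp: single_peaked_def single_dipped_def split: if_splits)
  have peaked: "R i \<in> single_peaked X" if "R \<in> P" "i \<in> A" for R i
    using dom[of R i] that \<open>A \<subseteq> {1..n}\<close> by auto
  have tops: "tops \<Omega> A R \<in> A \<rightarrow>\<^sub>E \<Omega>" if "R \<in> P" for R
    using best_single_peaked[OF peaked[OF that] assms(3) \<open>closed \<Omega>\<close>] xy(2)
    by (auto simp: tops_def)
  have SA: "{i \<in> A. tops \<Omega> A R i \<le> x} = S R \<inter> A" if "R \<in> P" for R
    using prefers_gap_iff_best_le[OF peaked[OF that] assms(3) \<open>closed \<Omega>\<close> xy(2-5)] \<open>A \<subseteq> {1..n}\<close>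
    by (auto simp: tops_def S_iff)
  \<comment> \<open>Membership in \<open>Q\<close> depends only on the supporters of
    \<open>x\<close> within \<open>A\<close>, so single-dipped agents can change their preferences
    without leaving \<open>Q\<close>.\<close>
  have Q_iff: "R \<in> Q \<longleftrightarrow> R \<in> P \<and> S R \<inter> A \<in> V" for R
    using omega_iff[OF tops[of R]] SA[of R] unfolding Q_def by fastforce
  have mem_omega: "z \<in> omega X n A f p \<longleftrightarrow> (\<exists>R\<in>P. tops \<Omega> A R = p \<and> f R = z)" for z p
    using assms(2) by (auto simp: omega_def P_def Let_def)
  \<comment> \<open>The outcome at \<open>R\<close> is by definition an element of the value of
    \<open>omega\<close> at the tops of \<open>R\<close>, which is \<open>{x, y}\<close>.\<close>
  have f_Q: "f R = x \<or> f R = y" if "R \<in> Q" for R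
    using mem_omega[of "f R" "tops \<Omega> A R"] that xy(1) unfolding Q_def by auto
  have "L \<alpha> \<subseteq> Pow A"
    using lcs \<alpha>(1) unfolding left_coalition_system_def by (elim conjE) (rule bspec)
  then have VD: "B \<in> L \<alpha> \<and> B \<subseteq> A" if "B \<in> V" for B
    using that by (auto simp: V_def)
  \<comment> \<open>The lower set \<open>B1\<close> brings \<open>B\<close> into
    \<open>L \<alpha>\<close>; the upper set \<open>B2\<close> keeps \<open>B\<close> out of
    \<open>L {x}\<close>, since otherwise \<open>B2\<close> would be in it as well.\<close>
  have V_convex: "B \<in> V" if "B1 \<in> V" "B2 \<in> V" "B1 \<subseteq> B" "B \<subseteq> B2" for B B1 B2
  proof -
    note up = left_coalition_system_upward[OF lcs]
    have "B2 \<subseteq> A" using VD[OF \<open>B2 \<in> V\<close>] by blast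
    have "B1 \<in> L \<alpha>" using VD[OF \<open>B1 \<in> V\<close>] by blast
    then have "B \<in> L \<alpha>"
      by (rule up[OF \<alpha>(1) _ \<open>B1 \<subseteq> B\<close> order.trans[OF \<open>B \<subseteq> B2\<close> \<open>B2 \<subseteq> A\<close>]])
    moreover have "B \<notin> L {x}" if "{x} \<in> r_omega X n A f"
    proof
      assume "B \<in> L {x}"
      then have "B2 \<in> L {x}" by (rule up[OF that _ \<open>B \<subseteq> B2\<close> \<open>B2 \<subseteq> A\<close>])
      then show False using \<open>B2 \<in> V\<close> that by (simp add: V_def)
    qed
    ultimately show ?thesis by (simp add: V_def)
  qed
  \<comment> \<open>If the outcome moved from \<open>x\<close> to \<open>y\<close>,
    strategy-proofness would apply to the deviation and to its reversal: agent \<open>i\<close> does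
    not prefer \<open>y\<close> under \<open>R i\<close>, hence prefers \<open>x\<close>, and does
    not prefer \<open>x\<close> under \<open>r\<close>. This contradicts
    \<open>mono\<close>.\<close>
  have step: "f (R(i := r)) = x"
    if "R \<in> Q" "R(i := r) \<in> Q" "i \<in> {1..n}" "f R = x"
      and mono: "prefers (R i) x y \<Longrightarrow> prefers r x y" for R i r
  proof (rule ccontr)
    assume "f (R(i := r)) \<noteq> x"
    then have fy: "f (R(i := r)) = y" using f_Q that by blast
    let ?D = "if i \<in> A then single_peaked X else single_dipped X"
    have RP: "R \<in> P" "R(i := r) \<in> P" using that by (auto simp: Q_def)
    have sp: "\<not> prefers (R' i) (f (R'(i := r'))) (f R')" if "R' \<in> P" "r' \<in> ?D" for R' r'
      using assms(6) that \<open>i \<in> {1..n}\<close> unfolding strategy_proof_def P_def by blast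
    have "\<not> prefers (R i) y x"
      using sp[of R r] dom[OF RP(2) \<open>i \<in> {1..n}\<close>] RP fy \<open>f R = x\<close> by simp
    moreover have "\<not> prefers r x y"
      using sp[of "R(i := r)" "R i"] dom[OF RP(1) \<open>i \<in> {1..n}\<close>] RP fy \<open>f R = x\<close> by simp
    ultimately show False
      using mono prefers_cases[OF agent_pref[OF RP(1) \<open>i \<in> {1..n}\<close>], of x y] xy assms(3) by auto
  qed
  have mono: "f R' = x" if "R \<in> Q" "R' \<in> Q" "S R \<subseteq> S R'" "f R = x" for R R'
  proof -
    \<comment> \<open>\<open>M T\<close> is the hybrid profile in which exactly the agents in
      \<open>T\<close> have already switched to \<open>R'\<close>. Its supporters lie between those
      of \<open>R\<close> and \<open>R'\<close>, so convexity of \<open>V\<close> keeps it in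
      \<open>Q\<close>.\<close>
    define M where "M T = (\<lambda>i. if i \<in> T then R' i else R i)" for T
    have RP: "R \<in> P" "R' \<in> P" using that by (auto simp: Q_def)
    have M_Q: "M T \<in> Q" for T
    proof -
      have "M T \<in> P" using RP unfolding P_def profiles_def M_def PiE_iff extensional_def by auto
      moreover have "S R \<subseteq> S (M T)" "S (M T) \<subseteq> S R'"
        using \<open>S R \<subseteq> S R'\<close> by (auto simp: S_iff M_def split: if_splits)
      then have "S R \<inter> A \<subseteq> S (M T) \<inter> A" "S (M T) \<inter> A \<subseteq> S R' \<inter> A" by blast+
      then have "S (M T) \<inter> A \<in> V"
        using V_convex[of "S R \<inter> A" "S R' \<inter> A" "S (M T) \<inter> A"] \<open>R \<in> Q\<close> \<open>R' \<in> Q\<close>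
        unfolding Q_iff by blast
      ultimately show ?thesis by (simp add: Q_iff)
    qed
    have "f (M T) = x" if "finite T" "T \<subseteq> {1..n}" for T
      using that
    proof (induction T rule: finite_induct)
      case empty
      then show ?case using \<open>f R = x\<close> by (simp add: M_def)
    next
      case (insert i T)
      have eq: "M (insert i T) = (M T)(i := R' i)" by (simp add: M_def fun_eq_iff)
      have "M T i = R i" using insert.hyps by (simp add: M_def)
      then have "prefers (M T i) x y \<Longrightarrow> prefers (R' i) x y"
        using \<open>S R \<subseteq> S R'\<close> insert.prems S_iff by auto
      moreover have "f (M T) = x" "i \<in> {1..n}" using insert by auto
      ultimately show ?case
        using step[OF M_Q[of T] M_Q[of "insert i T", unfolded eq]] unfolding eq by blast
    qed
    then have "f (M {1..n}) = x" by simp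
    \<comment> \<open>Outside \<open>{1..n}\<close> both sides are \<open>undefined\<close>, because
      profiles are extensional.\<close>
    moreover have "M {1..n} = R'"
      using RP PiE_arb unfolding P_def profiles_def M_def fun_eq_iff by metis
    ultimately show ?thesis by simp
  qed
  \<comment> \<open>\<open>U\<close> consists of the supporter sets at which \<open>x\<close> is
    actually chosen. By \<open>mono\<close>, every profile in \<open>Q\<close> whose supporters
    include a member of \<open>U\<close> also yields \<open>x\<close>, so the minimal members
    suffice to decide.\<close>
  define U where "U = S ` {R \<in> Q. f R = x}"
  define W where "W = {C. minimal_in U C}"
  have W_below: "\<exists>C\<in>W. C \<subseteq> S R" if "R \<in> Q" "f R = x" for R
  proof -
    have "finite (S R)" by (simp add: S_def left_supporters_def)
    then show ?thesis
      using finite_contains_minimal_in[of "S R" U] that unfolding W_def U_def by blast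
  qed
  have W_E: "\<exists>R\<in>Q. f R = x \<and> S R = C" if "C \<in> W" for C
    using that unfolding W_def U_def minimal_in_def by blast
  have W_sub: "W \<subseteq> Pow {1..n}" using W_E S_iff by fastforce
  have W_minimal: "minimal_collection W"
    unfolding minimal_collection_def W_def minimal_in_def by blast
  have g_W: "g \<alpha> R = (if \<exists>C\<in>W. C \<subseteq> S R then x else y)" if "R \<in> Q" for R
  proof -
    have "g \<alpha> R = f R"
      using assms(9) \<alpha> that unfolding binary_decision_functions_def Let_def assms(2) Q_def P_def
      by blast
    moreover have "f R = x" if "C \<in> W" "C \<subseteq> S R" for C
      using W_E[OF that(1)] that(2) mono \<open>R \<in> Q\<close> by blast
    ultimately show ?thesis using W_below[OF that] f_Q[OF that] by auto
  qed
  \<comment> \<open>A profile \<open>R'\<close> with the same tops as \<open>R\<close> but outcome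
    \<open>y\<close> exists because \<open>y\<close> belongs to the value of \<open>omega\<close>
    there. It has the same supporters within \<open>A\<close>. If \<open>C\<close> were contained in
    \<open>A\<close>, all of \<open>C\<close> would support \<open>x\<close> at \<open>R'\<close>,
    and \<open>mono\<close> would force the outcome \<open>x\<close>.\<close>
  have W_dipped: "C \<inter> ({1..n} - A) \<noteq> {}" if "C \<in> W" for C
  proof
    assume disj: "C \<inter> ({1..n} - A) = {}"
    obtain R where R: "R \<in> Q" "f R = x" "S R = C" using W_E[OF \<open>C \<in> W\<close>] by blast
    have "y \<in> omega X n A f (tops \<Omega> A R)" using R(1) xy(1) by (simp add: Q_def)
    then obtain R' where R': "R' \<in> P" "tops \<Omega> A R' = tops \<Omega> A R" "f R' = y"
      unfolding mem_omega by blast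
    then have "R' \<in> Q" using R(1) by (simp add: Q_def)
    have "S R' \<inter> A = S R \<inter> A" using SA[of R] SA[of R'] R R' by (simp add: Q_def)
    then have "S R \<subseteq> S R'" using disj S_iff R(3) by blast
    then show False using mono[OF R(1) \<open>R' \<in> Q\<close> _ R(2)] R'(3) xy(4) by simp
  qed
  have W_peaked: "\<exists>C\<in>W. C \<inter> A = B" if "minimal_in V B" for B
  proof -
    have B: "B \<in> V" "\<And>B'. B' \<in> V \<Longrightarrow> B' \<subseteq> B \<Longrightarrow> B' = B"
      using that unfolding minimal_in_def by auto
    have "B \<subseteq> A" using VD[OF B(1)] by blast
    \<comment> \<open>Tops at \<open>x\<close> on \<open>B\<close> and at \<open>y\<close> on the
      rest of \<open>A\<close> make \<open>B\<close> exactly the set of single-peaked supporters, so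
      \<open>omega\<close> takes the value \<open>\<alpha>\<close> and some profile with these tops
      yields \<open>x\<close>.\<close>
    define p where "p = (\<lambda>i\<in>A. if i \<in> B then x else y)"
    have p: "p \<in> A \<rightarrow>\<^sub>E \<Omega>" "{i \<in> A. p i \<le> x} = B"
      using xy \<open>B \<subseteq> A\<close> by (auto simp: p_def split: if_splits)
    then have "omega X n A f p = \<alpha>" using omega_iff B(1) by simp
    then have "x \<in> omega X n A f p" using xy(1) by simp
    then obtain R where R: "R \<in> P" "tops \<Omega> A R = p" "f R = x" unfolding mem_omega by blast
    then have "R \<in> Q" using \<open>omega X n A f p = \<alpha>\<close> by (simp add: Q_def)
    then obtain C where C: "C \<in> W" "C \<subseteq> S R" using W_below R(3) by blast
    \<comment> \<open>\<open>C\<close> is the full supporter set of some profile in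
      \<open>Q\<close>, so its part in \<open>A\<close> lies in \<open>V\<close>. Being contained in
      \<open>B\<close>, that part equals \<open>B\<close> by minimality.\<close>
    have "C \<inter> A \<in> V" using W_E[OF C(1)] Q_iff by blast
    moreover have "C \<inter> A \<subseteq> B" using C(2) SA[OF R(1)] R(2) p(2) by auto
    ultimately show ?thesis using B(2) C(1) by blast
  qed
  show "voting_by_left_decisive_sets X n A f L \<alpha> (g \<alpha>)"
    unfolding voting_by_left_decisive_sets_def assms(2) xy(6,7)
  proof (intro exI[of _ W] conjI ballI allI impI)
    fix R assume "R \<in> profiles X n A" "omega X n A f (tops \<Omega> A R) = \<alpha>"
    then have "R \<in> Q" by (simp add: Q_def P_def)
    from g_W[OF this]
    show "g \<alpha> R = (if \<exists>C\<in>W. C \<subseteq> left_supporters n \<alpha> R then x else y)"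
      unfolding S_def .
  next
    fix C assume "C \<in> W"
    then show "C \<inter> ({1..n} - A) \<noteq> {}" by (rule W_dipped)
  next
    fix B
    assume "minimal_in (L \<alpha> - (if {x} \<in> r_omega X n A f then L {x} else {})) B"
    then show "\<exists>C\<in>W. C \<inter> A = B" unfolding V_def[symmetric] by (rule W_peaked)
  qed (rule W_sub, rule W_minimal)
qed

end
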